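(* Let $r\ge 2$ and $\delta\ge 2r-2$ be integers. For every positive integer $p$ there is a connected $(2r-1)$-colorable (hence $K_{2r}$-free) graph $G_{r,\delta,p}$ of minimum degree $\delta$ and order $n=p\bigl((2r-1)\delta+2r-3\bigr)+2$, whose diameter is $\frac{(6r-5)n}{(2r-1)\delta+2r-3}+O(1)$ (the $O(1)$ term being bounded by a constant independent of $p$, $n$ and $\delta$). Moreover, \[\frac{(6r-5)\delta}{(2r-1)\delta+2r-3}>\frac{2(r-1)(3r+2)}{2r^2-1}\quad\text{if and only if}\quad \delta>12r^3-22r^2-2r+12=2(r-1)(3r+2)(2r-3),\] so for such $\delta$ these graphs have diameter exceeding $\frac{2(r-1)(3r+2)}{2r^2-1}\cdot\frac{n}{\delta}+O(1)$ as $p\to\infty$; and the difference $\frac{(6r-5)\delta}{(2r-1)\delta+2r-3}-\frac{2(r-1)(3r+2)}{2r^2-1}$ equals $\frac{1}{(2r^2-1)(2r-1)}+o(1)$ as $\delta\to\infty$.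
   Context: A graph is $K_{2r}$-free if it contains no complete subgraph on $2r$ vertices. The diameter is the maximum distance between two vertices. *)

theory Defs
  imports "Graph_Theory.Graph_Theory" "HOL-Library.Landau_Symbols"
begin

text \<open>
  Finite simple graphs are the symmetric, loop-free digraphs without parallel arcs of the locale
  \<^locale>\<open>graph\<close>: an undirected edge is a pair of opposite arcs, so the degree of a vertex is its
  out-degree.
\<close>

definition min_degree :: "('a, 'b) pre_digraph \<Rightarrow> nat" where
  "min_degree G = Min (out_degree G ` verts G)"

definition colorable :: "nat \<Rightarrow> ('a, 'b) pre_digraph \<Rightarrow> bool" where
  "colorable k G \<longleftrightarrow>
     (\<exists>c :: 'a \<Rightarrow> nat. c ` verts G \<subseteq> {..<k} \<and> (\<forall>(u, v) \<in> arcs_ends G. c u \<noteq> c v))"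

definition clique_free :: "nat \<Rightarrow> ('a, 'b) pre_digraph \<Rightarrow> bool" where
  "clique_free k G \<longleftrightarrow> \<not> (\<exists>H. subgraph H G \<and> complete_digraph k H)"

text \<open>
  With unit arc costs, the library's \<open>\<mu>\<close> is the length of a shortest walk, i.e. the distance;
  it is \<open>\<infinity>\<close> between different components.
\<close>

definition graph_diameter :: "('a, 'b) pre_digraph \<Rightarrow> ereal" where
  "graph_diameter G = Max {wf_digraph.\<mu> G (\<lambda>_. 1) u v | u v. u \<in> verts G \<and> v \<in> verts G}"

end

(* Write q = 2r - 2 and b_j = 1 + floor (j (delta - 2) / q), so b_0 = 1 and b_q = delta - 1.
   The graph is a chain of layers in which consecutive layers are completely joined and a layer
   is complete multipartite between its colour classes. A block has 3q + 1 = 6r - 5 layers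
     T_0 A_0 B_0 T_1 A_1 B_1 ... T_(q-1) A_(q-1) B_(q-1) T_q,
   where T_j is a single vertex of colour j, A_j has delta - b_j vertices shared evenly by the
   colours j+1, ..., q, and B_j has b_(j+1) vertices shared evenly by the colours 0, ..., j.
   Consecutive layers use disjoint colours, so q + 1 = 2r - 1 colours suffice. A vertex of T_j
   sees b_j + (delta - b_j) neighbours; in A_j and B_j every colour class has at most
   b_(j+1) - b_j + 1 vertices, because the b_j are as evenly spaced as possible, and this leaves
   degree at least delta. Putting p blocks in a row gives diameter p (6r - 5) - 1; the two ends of
   the chain lack a neighbouring T-vertex, which one extra vertex in the first A-layer and one in
   the last B-layer compensate. *)

theory Submission
  imports Defs "HOL-Library.Nat_Bijection"
begin

subsection \<open>Layered graphs\<close>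

text \<open>A vertex is one natural number coding its layer and its position there. The pairing is
  bijective, so layers of any sizes share the vertex type \<open>nat\<close>.\<close>

definition layer :: "nat \<Rightarrow> nat" where
  "layer v = fst (prod_decode v)"

definition position :: "nat \<Rightarrow> nat" where
  "position v = snd (prod_decode v)"

definition layered_verts :: "(nat \<Rightarrow> nat) \<Rightarrow> nat set" where
  "layered_verts a = {v. position v < a (layer v)}"

text \<open>Across consecutive layers colours are not consulted; there properness rests on
  \<open>colors_disjoint\<close> below. Inside a layer the colour condition also excludes
  loops.\<close>

definition layered_adj :: "(nat \<Rightarrow> nat \<Rightarrow> nat) \<Rightarrow> nat \<Rightarrow> nat \<Rightarrow> bool" where
  "layered_adj c u v \<longleftrightarrow> layer u = Suc (layer v) \<or> layer v = Suc (layer u) \<or>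
     (layer u = layer v \<and> c (layer u) (position u) \<noteq> c (layer v) (position v))"

definition layered_graph ::
    "(nat \<Rightarrow> nat) \<Rightarrow> (nat \<Rightarrow> nat \<Rightarrow> nat) \<Rightarrow> (nat, nat \<times> nat) pre_digraph" where
  "layered_graph a c =
     \<lparr>verts = layered_verts a,
      arcs = {(u, v). u \<in> layered_verts a \<and> v \<in> layered_verts a \<and> layered_adj c u v},
      tail = fst, head = snd\<rparr>"

lemma layer_prod_encode [simp]: "layer (prod_encode (l, s)) = l"
  and position_prod_encode [simp]: "position (prod_encode (l, s)) = s"
  by (simp_all add: layer_def position_def)

lemma prod_encode_layer_position [simp]: "prod_encode (layer v, position v) = v"
  by (simp add: layer_def position_def)

lemma layered_graph_simps [simp]:
  "verts (layered_graph a c) = layered_verts a"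
  "tail (layered_graph a c) = fst"
  "head (layered_graph a c) = snd"
  by (simp_all add: layered_graph_def)

lemma arcs_layered_graph [simp]:
  "(u, v) \<in> arcs (layered_graph a c) \<longleftrightarrow>
     u \<in> layered_verts a \<and> v \<in> layered_verts a \<and> layered_adj c u v"
  by (simp add: layered_graph_def)

lemma arcs_ends_layered_graph [simp]: "arcs_ends (layered_graph a c) = arcs (layered_graph a c)"
  by (auto simp: arcs_ends_conv)

lemma layered_adj_sym: "layered_adj c u v \<Longrightarrow> layered_adj c v u"
  by (auto simp: layered_adj_def)

lemma prod_encode_in_layered_verts [simp]:
  "prod_encode (l, s) \<in> layered_verts a \<longleftrightarrow> s < a l"
  by (simp add: layered_verts_def)

lemma bij_betw_layered_verts:
  "bij_betw prod_encode (SIGMA l:UNIV. {..<a l}) (layered_verts a)"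
proof (rule bij_betw_imageI)
  show "prod_encode ` (SIGMA l:UNIV. {..<a l}) = layered_verts a"
  proof (intro equalityI subsetI)
    fix v assume "v \<in> layered_verts a"
    then have "prod_encode (layer v, position v) \<in> prod_encode ` (SIGMA l:UNIV. {..<a l})"
      by (intro imageI) (simp add: layered_verts_def)
    then show "v \<in> prod_encode ` (SIGMA l:UNIV. {..<a l})" by simp
  qed auto
qed (auto simp: inj_on_def)

text \<open>\<open>layer_nonempty\<close> makes \<open>L\<close> the exact number of layers. With
  three layers, walks of length 2 between vertices of the same layer stay within the diameter
  \<open>L - 1\<close>.\<close>

locale layered =
  fixes L :: nat and a :: "nat \<Rightarrow> nat" and c :: "nat \<Rightarrow> nat \<Rightarrow> nat"
  assumes three_layers: "3 \<le> L"
    and layer_nonempty: "0 < a l \<longleftrightarrow> l < L"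
    and colors_disjoint: "s < a l \<Longrightarrow> t < a (Suc l) \<Longrightarrow> c l s \<noteq> c (Suc l) t"
begin

section \<open>Order, degrees and colouring of a layered graph\<close>

abbreviation "\<G> \<equiv> layered_graph a c"

lemma layer_less: "v \<in> layered_verts a \<Longrightarrow> layer v < L"
  using layer_nonempty[of "layer v"] by (auto simp: layered_verts_def)

lemma layered_verts_eq: "layered_verts a = prod_encode ` (SIGMA l:{..<L}. {..<a l})"
proof -
  have "(SIGMA l:UNIV. {..<a l}) = (SIGMA l:{..<L}. {..<a l})"
    using layer_nonempty by fastforce
  then show ?thesis
    using bij_betw_layered_verts[of a] by (simp add: bij_betw_def)
qed

lemma finite_layered_verts [simp]: "finite (layered_verts a)"
  unfolding layered_verts_eq by auto

lemma card_layered_verts: "card (layered_verts a) = (\<Sum>l<L. a l)"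
  unfolding layered_verts_eq
  by (subst card_image) (auto simp: inj_on_def)

lemma finite_arcs_layered: "finite (arcs \<G>)"
  by (rule finite_subset[of _ "layered_verts a \<times> layered_verts a"]) auto

sublocale graph \<G>
proof
  show "symmetric \<G>"
    by (auto simp: symmetric_def sym_def layered_adj_sym)
qed (auto simp: finite_arcs_layered arc_to_ends_def layered_adj_def)

text \<open>The neighbourhood is the disjoint union of the layer below, the layer above and the
  differently coloured part of the same layer. Layer 0 is separate because \<open>l - 1\<close>
  would be that layer itself; above the last layer \<open>a (Suc l)\<close> is 0.\<close>

lemma out_degree_layered:
  assumes "s < a l"
  shows "out_degree \<G> (prod_encode (l, s)) =
    (if l = 0 then 0 else a (l - 1)) + a (Suc l) + card {t. t < a l \<and> c l t \<noteq> c l s}"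
proof -
  let ?v = "prod_encode (l, s)"
  let ?D = "if l = 0 then {} else prod_encode ` ({l - 1} \<times> {..<a (l - 1)})"
  let ?U = "prod_encode ` ({Suc l} \<times> {..<a (Suc l)})"
  let ?S = "prod_encode ` ({l} \<times> {t. t < a l \<and> c l t \<noteq> c l s})"
  have inj: "inj_on prod_encode X" for X
    by (auto simp: inj_on_def)
  have nb: "w \<in> ?D \<union> ?U \<union> ?S \<longleftrightarrow> w \<in> layered_verts a \<and> layered_adj c ?v w" for w
  proof -
    obtain m t where "w = prod_encode (m, t)"
      by (metis prod_encode_layer_position)
    then show ?thesis
      by (auto simp: layered_adj_def image_iff)
  qed
  have "out_arcs \<G> ?v = Pair ?v ` {w. w \<in> layered_verts a \<and> layered_adj c ?v w}"
    using assms by (auto simp: out_arcs_def)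
  also have "{w. w \<in> layered_verts a \<and> layered_adj c ?v w} = ?D \<union> ?U \<union> ?S"
    using nb by blast
  finally have "out_arcs \<G> ?v = Pair ?v ` (?D \<union> ?U \<union> ?S)" .
  then have "out_degree \<G> ?v = card (?D \<union> ?U \<union> ?S)"
    unfolding out_degree_def by (simp add: card_image inj_on_def)
  also have "\<dots> = card ?D + card ?U + card ?S"
    by (subst card_Un_disjoint card_Un_disjoint; auto split: if_splits)+
  also have "card ?D = (if l = 0 then 0 else a (l - 1))"
    by (simp add: card_image inj)
  also have "card ?U = a (Suc l)"
    by (simp add: card_image inj)
  also have "card ?S = card {t. t < a l \<and> c l t \<noteq> c l s}"
    by (simp add: card_image inj card_cartesian_product)
  finally show ?thesis .
qed

lemma colorable_layered:
  assumes "\<And>l s. s < a l \<Longrightarrow> c l s < k"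
  shows "colorable k \<G>"
proof -
  let ?c = "\<lambda>v. c (layer v) (position v)"
  have "?c ` verts \<G> \<subseteq> {..<k}"
    using assms by (auto simp: layered_verts_def)
  moreover have "?c u \<noteq> ?c v" if "(u, v) \<in> arcs \<G>" for u v
    using that colors_disjoint[of "position u" "layer u" "position v"]
      colors_disjoint[of "position v" "layer v" "position u"]
    by (auto simp: layered_adj_def layered_verts_def)
  ultimately show ?thesis
    unfolding colorable_def by (intro exI[of _ ?c]) auto
qed

section \<open>Distances and diameter of a layered graph\<close>

lemma awalk_layer_le:
  "awalk u p v \<Longrightarrow> layer v \<le> layer u + length p"
proof (induction p arbitrary: u)
  case Nil
  then show ?case by (simp add: awalk_Nil_iff)
next
  case (Cons e p)
  then have "awalk (snd e) p v" "e \<in> arcs \<G>" "fst e = u"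
    by (auto simp: awalk_Cons_iff)
  \<comment> \<open>An arc raises the layer by at most one.\<close>
  with Cons.IH[of "snd e"] have "layer v \<le> layer (snd e) + length p" "layer (snd e) \<le> Suc (layer u)"
    by (cases e; auto simp: layered_adj_def)+
  then show ?case by simp
qed

text \<open>Consecutive layers are completely joined, so a walk can approach \<open>v\<close> by one
  layer per arc through arbitrary vertices and still end in \<open>v\<close> itself. The induction
  starts at \<open>d = 1\<close>: at 0 the ends could be different vertices of one layer.\<close>

lemma awalk_layers:
  assumes "u \<in> layered_verts a" "v \<in> layered_verts a" "1 \<le> d"
    and "layer v = layer u + d \<or> layer u = layer v + d"
  shows "\<exists>p. awalk u p v \<and> length p = d"
  using assms(3,1,2,4)
proof (induction d arbitrary: u rule: dec_induct)
  case base
  then have "awalk u [(u, v)] v"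
    by (auto simp: awalk_simps layered_adj_def)
  then show ?case by (intro exI[of _ "[(u, v)]"]) simp
next
  case (step d)
  define w where "w = prod_encode (if layer u < layer v then Suc (layer u) else layer u - 1, 0)"
  have w: "w \<in> layered_verts a" "layered_adj c u w" "layer v = layer w + d \<or> layer w = layer v + d"
    using step layer_less[of u] layer_less[of v] layer_nonempty
    by (auto simp: w_def layered_adj_def)
  then obtain p where "awalk w p v" "length p = d"
    using step by blast
  then have "awalk u ((u, w) # p) v \<and> length ((u, w) # p) = Suc d"
    using w step by (simp add: awalk_Cons_iff)
  then show ?case by blast
qed

lemma awalk_short:
  assumes "u \<in> layered_verts a" "v \<in> layered_verts a"
  shows "\<exists>p. awalk u p v \<and> length p \<le> L - 1"
proof (cases "layer u = layer v")
  case False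
  define d where "d = (if layer u < layer v then layer v - layer u else layer u - layer v)"
  have "1 \<le> d" "d \<le> L - 1" "layer v = layer u + d \<or> layer u = layer v + d"
    using False layer_less[OF assms(1)] layer_less[OF assms(2)] by (auto simp: d_def)
  then show ?thesis
    using awalk_layers[of u v d] assms by auto
next
  case True
  \<comment> \<open>Any vertex of an adjacent layer is joined to both \<open>u\<close> and
    \<open>v\<close>, which gives a walk of length 2 even if \<open>u = v\<close>.\<close>
  define w where "w = prod_encode (if layer u = 0 then 1 else layer u - 1, 0)"
  have w: "w \<in> layered_verts a" "layered_adj c u w" "layered_adj c w v"
    using True three_layers layer_less assms layer_nonempty
    by (auto simp: w_def layered_adj_def less_imp_diff_less)
  then have "awalk u [(u, w), (w, v)] v"
    using assms by (simp add: awalk_simps)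
  then show ?thesis
    using three_layers by (intro exI[of _ "[(u, w), (w, v)]"]) simp
qed

lemma connected_layered: "Digraph_Component.connected \<G>"
proof -
  have "prod_encode (0, 0) \<in> layered_verts a"
    using layer_nonempty three_layers by simp
  then have "verts \<G> \<noteq> {}"
    by (metis empty_iff layered_graph_simps(1))
  moreover have "u \<rightarrow>\<^sup>*\<^bsub>\<G>\<^esub> v" if "u \<in> layered_verts a" "v \<in> layered_verts a" for u v
    using awalk_short[OF that] by (auto simp: reachable_awalk)
  ultimately show ?thesis
    unfolding Digraph_Component.connected_def
    by (intro strongly_connectedI) (simp_all add: reachable_mk_symmetricI)
qed

lemma graph_diameter_layered: "graph_diameter \<G> = ereal (real (L - 1))"
proof -
  have cost: "awalk_cost (\<lambda>_. 1) p = real (length p)" for p :: "(nat \<times> nat) list"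
    by (induction p) (auto simp: awalk_cost_def)
  let ?S = "{\<mu> (\<lambda>_. 1) u v | u v. u \<in> verts \<G> \<and> v \<in> verts \<G>}"
  have "?S = (\<lambda>(u, v). \<mu> (\<lambda>_. 1) u v) ` (layered_verts a \<times> layered_verts a)"
    by auto
  then have "finite ?S" by simp
  have upper: "x \<le> ereal (real (L - 1))" if "x \<in> ?S" for x
  proof -
    from that obtain u v where uv: "u \<in> layered_verts a" "v \<in> layered_verts a"
      and x: "x = \<mu> (\<lambda>_. 1) u v" by auto
    from awalk_short[OF uv] obtain p where p: "awalk u p v" "length p \<le> L - 1" by blast
    from min_cost_le_walk_cost[OF p(1), of "\<lambda>_. 1"] p(2) show ?thesis
      unfolding x cost by (meson ereal_less_eq(3) of_nat_mono order_trans)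
  qed
  \<comment> \<open>The bound is attained between the ends of the chain, where every walk has to
    climb \<open>L - 1\<close> layers.\<close>
  define u v where "u = prod_encode (0, 0)" and "v = prod_encode (L - 1, 0)"
  have uv: "u \<in> layered_verts a" "v \<in> layered_verts a"
    using layer_nonempty three_layers by (auto simp: u_def v_def)
  have "ereal (real (L - 1)) \<le> \<mu> (\<lambda>_. 1) u v"
    unfolding \<mu>_def cost
    using awalk_layer_le[of u _ v] by (intro INF_greatest) (auto simp: u_def v_def)
  then have "\<mu> (\<lambda>_. 1) u v = ereal (real (L - 1))"
    using upper[of "\<mu> (\<lambda>_. 1) u v"] uv by (intro antisym) auto
  then have "ereal (real (L - 1)) \<in> ?S"
    using uv by (metis (mono_tags, lifting) layered_graph_simps(1) mem_Collect_eq)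
  with \<open>finite ?S\<close> upper show ?thesis
    unfolding graph_diameter_def by (intro Max_eqI) auto
qed

end

section \<open>Colourings and cliques\<close>

lemma colorable_imp_clique_free:
  assumes "colorable k G" "k < m"
  shows "clique_free m G"
  unfolding clique_free_def
proof (intro notI, elim exE conjE)
  fix H assume H: "subgraph H G" "complete_digraph m H"
  from assms(1) obtain f :: "'a \<Rightarrow> nat" where
    f: "f ` verts G \<subseteq> {..<k}" "\<forall>(u, v) \<in> arcs_ends G. f u \<noteq> f v"
    unfolding colorable_def by (elim exE conjE)
  have sub: "verts H \<subseteq> verts G" "arcs_ends H \<subseteq> arcs_ends G"
    using H(1) by (auto dest: arcs_ends_mono)
  \<comment> \<open>Distinct vertices of a clique are adjacent, so a proper colouring separates
    them.\<close>
  have "inj_on f (verts H)"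
    using H(2) sub(2) f(2) by (fastforce simp: complete_digraph_def inj_on_def)
  then have "card (verts H) \<le> card {..<k}"
    using f(1) sub(1) by (intro card_inj_on_le) auto
  then show False
    using H(2) assms(2) by (simp add: complete_digraph_def)
qed

subsection \<open>The clump construction\<close>

definition stair :: "nat \<Rightarrow> nat \<Rightarrow> nat \<Rightarrow> nat" where
  "stair q \<delta> j = Suc (j * (\<delta> - 2) div q)"

text \<open>The offset \<open>x\<close> in a block encodes a layer of the pattern:
  \<open>x div 3\<close> is the index \<open>j\<close>, and the residue mod 3 selects
  \<open>T_j\<close>, \<open>A_j\<close> or \<open>B_j\<close>.\<close>

definition block_size :: "nat \<Rightarrow> nat \<Rightarrow> nat \<Rightarrow> nat" where
  "block_size q \<delta> x =
     (if x mod 3 = 0 then 1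
      else if x mod 3 = 1 then \<delta> - stair q \<delta> (x div 3)
      else stair q \<delta> (Suc (x div 3)))"

definition block_length :: "nat \<Rightarrow> nat" where
  "block_length q = 3 * q + 1"

text \<open>The enlarged layers are \<open>A_0\<close> of the first block, at 1, and
  \<open>B_(q-1)\<close> of the last block, which is next to last because the chain ends with
  \<open>T_q\<close>.\<close>

definition clump_size :: "nat \<Rightarrow> nat \<Rightarrow> nat \<Rightarrow> nat \<Rightarrow> nat" where
  "clump_size q \<delta> p l =
     (if l < p * block_length q
      then block_size q \<delta> (l mod block_length q) +
        (if l = 1 \<or> l = p * block_length q - 2 then 1 else 0)
      else 0)"

text \<open>Dealing out the colours cyclically by position turns colour classes into residue classes
  and covers the extra vertex of an enlarged layer by the same rule.\<close>

definition clump_color :: "nat \<Rightarrow> nat \<Rightarrow> nat \<Rightarrow> nat" where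
  "clump_color q l s =
     (let x = l mod block_length q; j = x div 3 in
      if x mod 3 = 0 then j
      else if x mod 3 = 1 then Suc j + s mod (q - j)
      else s mod Suc j)"

section \<open>Residue classes and floors of multiples\<close>

lemma card_mod_class_le:
  fixes k :: nat
  assumes "n \<le> k * m"
  shows "card {t. t < n \<and> t mod k = i} \<le> m"
proof (cases "k = 0")
  case False
  \<comment> \<open>Within a residue class the quotient determines the element, and all quotients
    lie below \<open>m\<close>.\<close>
  have "inj_on (\<lambda>t. t div k) {t. t < n \<and> t mod k = i}"
    by (rule inj_onI) (metis (mono_tags, lifting) div_mult_mod_eq mem_Collect_eq)
  moreover have "(\<lambda>t. t div k) ` {t. t < n \<and> t mod k = i} \<subseteq> {..<m}"
    using assms by (auto simp: less_mult_imp_div_less mult.commute)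
  ultimately have "card {t. t < n \<and> t mod k = i} \<le> card {..<m}"
    by (intro card_inj_on_le) auto
  then show ?thesis by simp
qed (use assms in simp)

text \<open>
  \<open>Suc (g - f)\<close> bounds the colour classes of \<open>A\<^sub>j\<close> and \<open>B\<^sub>j\<close>. Both estimates rest on
  \<open>e < q * Suc (g - f)\<close>: consecutive floors differ by more than \<open>e / q - 1\<close>.
\<close>

lemma floor_multiples_step:
  fixes q e j :: nat
  defines "f \<equiv> j * e div q" and "g \<equiv> Suc j * e div q"
  assumes "j < q"
  shows "f \<le> g" "Suc g \<le> Suc j * Suc (g - f)" "Suc e - f \<le> (q - j) * Suc (g - f)"
proof -
  have q: "0 < q" using assms by simp
  show fg: "f \<le> g" unfolding f_def g_def by (intro div_le_mono) simp
  \<comment> \<open>Over the integers differences are not truncated; \<open>D\<close> is the bound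
    on a colour class.\<close>
  define Q E J F G where "Q = int q" and "E = int e" and "J = int j" and "F = int f" and "G = int g"
  define D where "D = G - F + 1"
  have D: "int (Suc (g - f)) = D" using fg by (simp add: D_def F_def G_def)
  have "q * f \<le> j * e" "j * e < q * f + q" "q * g \<le> Suc j * e" "Suc j * e < q * g + q"
    using dividend_less_times_div[OF q, of "j * e"] dividend_less_times_div[OF q, of "Suc j * e"]
      times_div_less_eq_dividend[of q "j * e"] times_div_less_eq_dividend[of q "Suc j * e"]
    unfolding f_def g_def by linarith+
  then have bnd: "Q * F \<le> J * E" "J * E < Q * F + Q" "Q * G \<le> (J + 1) * E" "(J + 1) * E < Q * G + Q"
    unfolding Q_def E_def J_def F_def G_def
    by (simp_all flip: of_nat_mult of_nat_add of_nat_Suc add: add.commute)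
  have Q: "0 < Q" "J + 1 \<le> Q" "0 \<le> J" using assms q by (auto simp: Q_def J_def)
  have QD: "E + 1 \<le> Q * D" using bnd by (simp add: D_def algebra_simps)
  have "(J + 1) * (E + 1) \<le> (J + 1) * (Q * D)"
    using QD Q by (intro mult_left_mono) auto
  then have "Q * G < Q * ((J + 1) * D)" using bnd Q by (simp add: algebra_simps)
  then have "G < (J + 1) * D" using Q by simp
  then have "int (Suc g) \<le> int (Suc j * Suc (g - f))"
    unfolding of_nat_mult D by (simp add: G_def J_def add.commute)
  then show "Suc g \<le> Suc j * Suc (g - f)" by linarith
  \<comment> \<open>The factor \<open>Q - J - 1\<close> is nonnegative because \<open>j < q\<close>.
    This bounds \<open>E - G\<close>; adding \<open>D = G - F + 1\<close> then raises the factor to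
    \<open>Q - J\<close>.\<close>
  have "(Q - J - 1) * (E + 1) \<le> (Q - J - 1) * (Q * D)"
    using QD Q by (intro mult_left_mono) auto
  then have "Q * (E - G) < Q * ((Q - J - 1) * D + 1)"
    using bnd Q by (simp add: algebra_simps)
  then have "E - G < (Q - J - 1) * D + 1" using Q by simp
  then have "E + 1 - F \<le> (Q - J) * D" by (simp add: D_def algebra_simps)
  moreover have "int ((q - j) * Suc (g - f)) = (Q - J) * D"
    unfolding of_nat_mult D using assms(3) by (simp add: Q_def J_def of_nat_diff)
  ultimately have "int (Suc e) - int f \<le> int ((q - j) * Suc (g - f))"
    by (simp add: E_def F_def)
  then show "Suc e - f \<le> (q - j) * Suc (g - f)" by linarith
qed

section \<open>Sizes and colours of the layers in block coordinates\<close>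

locale clump_layers =
  fixes q \<delta> p :: nat
  assumes q_ge: "2 \<le> q" and delta_ge: "2 \<le> \<delta>" and p_ge: "1 \<le> p"
begin

abbreviation "b \<equiv> stair q \<delta>"
abbreviation "M \<equiv> block_length q"
abbreviation "a \<equiv> clump_size q \<delta> p"
abbreviation "c \<equiv> clump_color q"

lemma stair_0 [simp]: "b 0 = 1" and stair_q [simp]: "b q = \<delta> - 1"
  using q_ge delta_ge by (auto simp: stair_def)

lemma stair_pos: "1 \<le> b j"
  by (simp add: stair_def)

lemma stair_le: "j \<le> q \<Longrightarrow> b j \<le> \<delta> - 1"
  using div_le_mono[OF mult_le_mono1[of j q "\<delta> - 2"], of q] q_ge delta_ge by (simp add: stair_def)

text \<open>These are the floor estimates at \<open>\<delta> - 2\<close>. Apart from extra vertices,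
  \<open>B_j\<close> has \<open>b (Suc j)\<close> vertices in \<open>Suc j\<close> colours and
  \<open>A_j\<close> has \<open>\<delta> - b j\<close> vertices in \<open>q - j\<close> colours; one
  bound on the classes serves both.\<close>

lemma stair_step:
  assumes "j < q"
  shows "b j \<le> b (Suc j)" "b (Suc j) \<le> Suc j * Suc (b (Suc j) - b j)"
    "\<delta> - b j \<le> (q - j) * Suc (b (Suc j) - b j)"
proof -
  note floor = floor_multiples_step[OF assms, of "\<delta> - 2"]
  show "b j \<le> b (Suc j)" "b (Suc j) \<le> Suc j * Suc (b (Suc j) - b j)"
    unfolding stair_def diff_Suc_Suc using floor(1,2) by (simp_all only: Suc_le_mono)
  have "\<delta> - b j = Suc (\<delta> - 2) - j * (\<delta> - 2) div q"
    using delta_ge unfolding stair_def by linarith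
  then show "\<delta> - b j \<le> (q - j) * Suc (b (Suc j) - b j)"
    unfolding stair_def diff_Suc_Suc using floor(3) by (simp only:)
qed

text \<open>Division by \<open>M\<close> gives the block \<open>k\<close>, division of the offset by
  3 the index \<open>j\<close>. As \<open>M = 3 * q + 1\<close>, a block ends with
  \<open>T_q\<close>, so only the case \<open>T\<close> allows \<open>j = q\<close>.\<close>

lemma layer_cases:
  assumes "l < p * M"
  obtains (T) k j where "l = k * M + 3 * j" "k < p" "j \<le> q"
    | (A) k j where "l = k * M + (3 * j + 1)" "k < p" "j < q"
    | (B) k j where "l = k * M + (3 * j + 2)" "k < p" "j < q"
proof -
  define k x j where "k = l div M" and "x = l mod M" and "j = x div 3"
  have l: "l = k * M + x" "k < p"
    using assms by (simp_all add: k_def x_def less_mult_imp_div_less)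
  have x: "x < 3 * q + 1" by (simp add: x_def block_length_def)
  have "x mod 3 = 0 \<or> x mod 3 = 1 \<or> x mod 3 = 2" by linarith
  moreover have "x = 3 * j + x mod 3" by (simp add: j_def)
  ultimately consider "x = 3 * j" | "x = 3 * j + 1" | "x = 3 * j + 2" by fastforce
  then show thesis
  proof cases
    case 1
    with l x T[of k j] show thesis by simp
  next
    case 2
    with l x A[of k j] show thesis by simp
  next
    case 3
    with l x B[of k j] show thesis by simp
  qed
qed

lemma in_block: "k < p \<Longrightarrow> x < M \<Longrightarrow> k * M + x < p * M"
  using mult_le_mono1[of "Suc k" p M] by simp

lemma block_mod: "x < M \<Longrightarrow> (k * M + x) mod M = x"
  by simp

lemma block_eq_iff:
  assumes "x < M" "y < M"
  shows "k * M + x = m * M + y \<longleftrightarrow> k = m \<and> x = y"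
proof
  assume eq: "k * M + x = m * M + y"
  then have "(k * M + x) mod M = (m * M + y) mod M" by (simp only:)
  then have "x = y" by (simp only: block_mod assms)
  moreover from this eq have "k * M = m * M" by simp
  moreover have "M \<noteq> 0" by (simp add: block_length_def)
  ultimately show "k = m \<and> x = y" by simp
qed simp

lemma size_block:
  assumes "k < p" "x < M"
  shows "a (k * M + x) = block_size q \<delta> x +
    (if k = 0 \<and> x = 1 \<or> Suc k = p \<and> x = 3 * q - 1 then 1 else 0)"
proof -
  have "1 < M" "3 * q - 1 < M" using q_ge by (auto simp: block_length_def)
  \<comment> \<open>The second enlarged layer has offset \<open>M - 2 = 3 * q - 1\<close> in the
    last block.\<close>
  moreover have "p * M - 2 = (p - 1) * M + (3 * q - 1)"
  proof -
    have "p * M = (p - 1) * M + M" using p_ge by (cases p) auto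
    moreover have "M - 2 = 3 * q - 1" "2 \<le> M" using q_ge by (auto simp: block_length_def)
    ultimately show ?thesis by linarith
  qed
  ultimately have "k * M + x = 1 \<longleftrightarrow> k = 0 \<and> x = 1"
      "k * M + x = p * M - 2 \<longleftrightarrow> Suc k = p \<and> x = 3 * q - 1"
    using block_eq_iff[OF assms(2), of 1 k 0] block_eq_iff[OF assms(2), of "3 * q - 1" k "p - 1"]
      p_ge by auto
  then show ?thesis
    using in_block[OF assms] assms(2) by (simp only: clump_size_def block_mod if_True)
qed

lemma color_block:
  assumes "x < M"
  shows "c (k * M + x) s = (if x mod 3 = 0 then x div 3
      else if x mod 3 = 1 then Suc (x div 3) + s mod (q - x div 3)
      else s mod Suc (x div 3))"
  unfolding clump_color_def Let_def block_mod[OF assms] ..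

lemma block_size_simps:
  "block_size q \<delta> (3 * j) = 1"
  "block_size q \<delta> (3 * j + 1) = \<delta> - b j"
  "block_size q \<delta> (3 * j + 2) = b (Suc j)"
proof -
  have "(3 * j) mod 3 = 0" "(3 * j) div 3 = j" "(3 * j + 1) mod 3 = 1" "(3 * j + 1) div 3 = j"
    "(3 * j + 2) mod 3 = 2" "(3 * j + 2) div 3 = j" by presburger+
  then show "block_size q \<delta> (3 * j) = 1" "block_size q \<delta> (3 * j + 1) = \<delta> - b j"
    "block_size q \<delta> (3 * j + 2) = b (Suc j)"
    by (simp_all only: block_size_def) simp_all
qed

lemma size_T:
  assumes "k < p" "j \<le> q" shows "a (k * M + 3 * j) = 1"
proof -
  have "3 * j \<noteq> 1" "3 * j \<noteq> 3 * q - 1" "3 * j < M"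
    using assms q_ge unfolding block_length_def by presburger+
  then show ?thesis
    using size_block[OF assms(1), of "3 * j"] by (simp only: block_size_simps) simp
qed

lemma size_A:
  assumes "k < p" "j < q"
  shows "a (k * M + (3 * j + 1)) = \<delta> - b j + (if k = 0 \<and> j = 0 then 1 else 0)"
proof -
  have "3 * j + 1 = 1 \<longleftrightarrow> j = 0" "3 * j + 1 \<noteq> 3 * q - 1" "3 * j + 1 < M"
    using assms q_ge unfolding block_length_def by presburger+
  then show ?thesis
    using size_block[OF assms(1), of "3 * j + 1"] by (simp only: block_size_simps) simp
qed

lemma size_B:
  assumes "k < p" "j < q"
  shows "a (k * M + (3 * j + 2)) = b (Suc j) + (if Suc k = p \<and> Suc j = q then 1 else 0)"
proof -
  have "3 * j + 2 \<noteq> 1" "3 * j + 2 = 3 * q - 1 \<longleftrightarrow> Suc j = q" "3 * j + 2 < M"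
    using assms q_ge unfolding block_length_def by presburger+
  then show ?thesis
    using size_block[OF assms(1), of "3 * j + 2"] by (simp only: block_size_simps) simp
qed

lemma size_zero: "p * M \<le> l \<Longrightarrow> a l = 0"
  by (simp add: clump_size_def)

lemma color_T:
  assumes "j \<le> q" shows "c (k * M + 3 * j) s = j"
proof -
  have "3 * j < M" "(3 * j) mod 3 = 0" "(3 * j) div 3 = j"
    using assms unfolding block_length_def by presburger+
  then show ?thesis by (simp only: color_block) simp
qed

lemma color_A:
  assumes "j < q" shows "c (k * M + (3 * j + 1)) s = Suc j + s mod (q - j)"
proof -
  have "3 * j + 1 < M" "(3 * j + 1) mod 3 = 1" "(3 * j + 1) div 3 = j"
    using assms unfolding block_length_def by presburger+
  then show ?thesis by (simp only: color_block) simp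
qed

lemma color_B:
  assumes "j < q" shows "c (k * M + (3 * j + 2)) s = s mod Suc j"
proof -
  have "3 * j + 2 < M" "(3 * j + 2) mod 3 = 2" "(3 * j + 2) div 3 = j"
    using assms unfolding block_length_def by presburger+
  then show ?thesis by (simp only: color_block) simp
qed

text \<open>The right-hand sides keep the shape in which sizes and colours are stated; hence the
  \<open>3 * 0\<close> for the \<open>T_0\<close> that directly follows a
  \<open>T_q\<close>.\<close>

lemma Suc_T: "Suc (k * M + 3 * j) = k * M + (3 * j + 1)"
  and Suc_A: "Suc (k * M + (3 * j + 1)) = k * M + (3 * j + 2)"
  and Suc_B: "Suc (k * M + (3 * j + 2)) = k * M + 3 * Suc j"
  and Suc_last: "Suc (k * M + 3 * q) = Suc k * M + 3 * 0"
  by (simp_all add: block_length_def)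

lemma size_pos_iff: "0 < a l \<longleftrightarrow> l < p * M"
proof
  assume "l < p * M"
  then show "0 < a l"
  proof (cases rule: layer_cases)
    case (A k j)
    then show ?thesis using stair_le[of j] delta_ge by (simp only: size_A) simp
  next
    case (B k j)
    then show ?thesis using stair_pos[of "Suc j"] by (simp only: size_B)
  qed (simp only: size_T zero_less_one)
next
  assume "0 < a l"
  then show "l < p * M" using size_zero[of l] by (cases "p * M \<le> l") simp_all
qed

lemma color_less:
  assumes "s < a l" shows "c l s < Suc q"
proof -
  have "l < p * M" using assms size_pos_iff[of l] by simp
  then show ?thesis
  proof (cases rule: layer_cases)
    case (T k j)
    then show ?thesis by (simp only: color_T less_Suc_eq_le)
  next
    case (A k j)
    then have "s mod (q - j) < q - j" by simp
    with A show ?thesis unfolding A(1) color_A[OF A(3)] by linarith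
  next
    case (B k j)
    have "s mod Suc j < Suc j" by simp
    with B(3) show ?thesis unfolding B(1) color_B[OF B(3)] by linarith
  qed
qed

text \<open>\<open>T_j\<close> has colour \<open>j\<close>, \<open>A_j\<close> only larger colours,
  \<open>B_j\<close> only colours up to \<open>j\<close>, and the next \<open>T\<close> has
  \<open>j + 1\<close>. Between blocks the colours are \<open>q\<close> and 0.\<close>

lemma color_consecutive:
  assumes "s < a l" "t < a (Suc l)"
  shows "c l s \<noteq> c (Suc l) t"
proof -
  have "l < p * M" using assms size_pos_iff[of l] by simp
  then show ?thesis
  proof (cases rule: layer_cases)
    case (T k j)
    show ?thesis
    proof (cases "j = q")
      case True
      have "c (Suc l) t = 0"
        using color_T[of 0 "Suc k"] by (simp only: T True Suc_last)
      then show ?thesis using T True color_T[of q k] q_ge by simp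
    next
      case False
      then have "j < q" using T by simp
      then show ?thesis
        using color_A[of j k t] T color_T[of j k s] by (simp only: Suc_T)
    qed
  next
    case (A k j)
    have "t mod Suc j < Suc j" by simp
    with A show ?thesis by (simp only: Suc_A color_A color_B)
  next
    case (B k j)
    have "s mod Suc j < Suc j" by simp
    with B color_T[of "Suc j" k t] show ?thesis by (simp only: Suc_B color_B Suc_leI)
  qed
qed

sublocale layered "p * M" a c
proof
  show "3 \<le> p * M"
    using p_ge q_ge mult_le_mono1[of 1 p M] by (simp add: block_length_def)
qed (rule size_pos_iff, rule color_consecutive)

section \<open>The number of vertices\<close>

lemma sum_block_size: "m \<le> q \<Longrightarrow> (\<Sum>x<3 * m + 1. block_size q \<delta> x) + 1 = 1 + m * (\<delta> + 1) + b m"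
proof (induction m)
  case 0
  then show ?case using block_size_simps(1)[of 0] by simp
next
  case (Suc m)
  \<comment> \<open>The induction step adds \<open>A_m\<close>, \<open>B_m\<close> and the next
    \<open>T\<close>, of total size \<open>\<delta> + 1 + b (Suc m) - b m\<close>, so the sum
    telescopes. The 1 added on the left is \<open>b 0\<close>.\<close>
  have "{..<3 * Suc m + 1} = insert (3 * m + 1) (insert (3 * m + 2) (insert (3 * Suc m) {..<3 * m + 1}))"
    by auto
  then have "(\<Sum>x<3 * Suc m + 1. block_size q \<delta> x) =
      (\<Sum>x<3 * m + 1. block_size q \<delta> x) + (\<delta> - b m) + b (Suc m) + 1"
    by (simp add: block_size_simps[simplified] block_size_simps(1)[of "Suc m", simplified])
  then show ?case using Suc stair_le[of m] delta_ge by simp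
qed

lemma card_verts_clump: "card (layered_verts a) = p * (q * (\<delta> + 1) + \<delta> - 1) + 2"
proof -
  have "(\<Sum>l<p * M. block_size q \<delta> (l mod M)) = (\<Sum>k<p. \<Sum>l\<in>{k * M..<k * M + M}. block_size q \<delta> (l mod M))"
    by (rule sum.nat_group[symmetric])
  also have "\<dots> = (\<Sum>k<p. \<Sum>x<M. block_size q \<delta> x)"
  proof (rule sum.cong)
    fix k
    have "(\<Sum>l\<in>{k * M..<k * M + M}. block_size q \<delta> (l mod M)) =
        (\<Sum>x\<in>{0..<M}. block_size q \<delta> ((k * M + x) mod M))"
      using sum.shift_bounds_nat_ivl[of "\<lambda>l. block_size q \<delta> (l mod M)" 0 "k * M" M]
      by (simp add: add.commute)
    then show "(\<Sum>l\<in>{k * M..<k * M + M}. block_size q \<delta> (l mod M)) = (\<Sum>x<M. block_size q \<delta> x)"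
      by (simp add: atLeast0LessThan)
  qed simp
  also have "(\<Sum>x<M. block_size q \<delta> x) = q * (\<delta> + 1) + \<delta> - 1"
    using sum_block_size[of q] delta_ge by (simp add: block_length_def)
  finally have main: "(\<Sum>l<p * M. block_size q \<delta> (l mod M)) = p * (q * (\<delta> + 1) + \<delta> - 1)"
    by simp
  \<comment> \<open>With at least 7 layers the two enlarged layers are different and contribute
    exactly 2.\<close>
  have "7 \<le> p * M"
    using p_ge q_ge mult_le_mono1[of 1 p M] by (simp add: block_length_def)
  then have "{l \<in> {..<p * M}. l = 1 \<or> l = p * M - 2} = {1, p * M - 2}" "1 \<noteq> p * M - 2" by auto
  then have "(\<Sum>l<p * M. if l = 1 \<or> l = p * M - 2 then 1 else 0) = (2::nat)"
    by (simp add: sum.If_cases Int_def)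
  then have "(\<Sum>l<p * M. a l) = p * (q * (\<delta> + 1) + \<delta> - 1) + 2"
    using main by (simp add: clump_size_def sum.distrib)
  then show ?thesis by (simp add: card_layered_verts)
qed

section \<open>Minimum degree\<close>

lemma card_split:
  "card {t. t < a l \<and> c l t \<noteq> c l s} + card {t. t < a l \<and> c l t = c l s} = a l"
proof -
  have "card {t. t < a l \<and> c l t \<noteq> c l s} + card {t. t < a l \<and> c l t = c l s} =
      card ({t. t < a l \<and> c l t \<noteq> c l s} \<union> {t. t < a l \<and> c l t = c l s})"
    by (subst card_Un_disjoint) auto
  also have "{t. t < a l \<and> c l t \<noteq> c l s} \<union> {t. t < a l \<and> c l t = c l s} = {..<a l}"
    by auto
  finally show ?thesis by simp
qed

text \<open>For \<open>T_j\<close> the neighbouring layers suffice. For \<open>A_j\<close> and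
  \<open>B_j\<close> the layer and its two neighbours hold at least
  \<open>\<delta> + Suc (b (Suc j) - b j)\<close> vertices plus a possible extra one in the layer,
  and the vertex misses only its own colour class.\<close>

lemma out_degree_ge:
  assumes "s < a l"
  shows "\<delta> \<le> out_degree \<G> (prod_encode (l, s))"
proof -
  have "l < p * M" using assms size_pos_iff[of l] by simp
  then show ?thesis
  proof (cases rule: layer_cases)
    case (T k j)
    \<comment> \<open>Before the \<open>T_0\<close> of a later block stands the single vertex of a
      \<open>T_q\<close>, matching \<open>b 0 = 1\<close>. At the end of the chain
      \<open>B_(q-1)\<close> has its extra vertex.\<close>
    have left: "b j + (if k = p - 1 \<and> j = q then 1 else 0) \<le> a (l - 1)" if "l \<noteq> 0"
    proof (cases j)
      case 0
      then have "k \<noteq> 0" using that T by simp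
      then have "l - 1 = (k - 1) * M + 3 * q"
        using T 0 Suc_last[of "k - 1"] by simp
      then show ?thesis using 0 q_ge size_T[of "k - 1" q] T by simp
    next
      case (Suc i)
      then have "l - 1 = k * M + (3 * i + 2)" using T by simp
      then show ?thesis using size_B[of k i] T Suc by simp
    qed
    \<comment> \<open>After an inner \<open>T_q\<close>, the following \<open>T_0\<close> supplies
      \<open>\<delta> - b q = 1\<close>. At the start of the chain the extra vertex of
      \<open>A_0\<close> raises the count to \<open>\<delta>\<close>.\<close>
    have right: "\<delta> - b j + (if l = 0 then 1 else 0) \<le> a (Suc l)" if "\<not> (k = p - 1 \<and> j = q)"
    proof (cases "j = q")
      case True
      then have "l \<noteq> 0" "Suc k < p" using T q_ge that by auto
      moreover from this have "a (Suc l) = 1"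
        using size_T[of "Suc k" 0] by (simp only: T True Suc_last)
      ultimately show ?thesis using True delta_ge by simp
    next
      case False
      then have "j < q" using T by simp
      have "a (Suc l) = \<delta> - b j + (if k = 0 \<and> j = 0 then 1 else 0)"
        unfolding T(1) Suc_T by (rule size_A[OF \<open>k < p\<close> \<open>j < q\<close>])
      moreover have "k = 0 \<and> j = 0" if "l = 0"
        using T(1) that by (simp add: block_length_def)
      ultimately show ?thesis by (cases "l = 0") simp_all
    qed
    have bj: "b j \<le> \<delta> - 1" using stair_le T by simp
    have l0: "l = 0 \<Longrightarrow> j = 0" "l = 0 \<Longrightarrow> j \<noteq> q" using T q_ge by auto
    consider "l = 0" | "l \<noteq> 0" "k = p - 1 \<and> j = q" | "l \<noteq> 0" "\<not> (k = p - 1 \<and> j = q)"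
      by blast
    then show ?thesis
    proof cases
      case 1
      then show ?thesis
        unfolding out_degree_layered[OF assms] using l0 right bj by simp
    next
      case 2
      then show ?thesis
        unfolding out_degree_layered[OF assms] using left bj delta_ge by simp
    next
      case 3
      then show ?thesis
        unfolding out_degree_layered[OF assms] using left right bj by simp
    qed
  next
    case (A k j)
    let ?e = "if k = 0 \<and> j = 0 then 1 else 0 :: nat"
    let ?m = "Suc (b (Suc j) - b j)"
    have al: "a l = \<delta> - b j + ?e" using A size_A by simp
    have prev: "l \<noteq> 0" "a (l - 1) = 1" using A size_T[of k j] by simp_all
    have succ: "b (Suc j) \<le> a (Suc l)" using A size_B[of k j] by (simp only: Suc_A le_add1)
    \<comment> \<open>An extra vertex costs at most one in the class bound, as \<open>q - j\<close>
      is positive, and is regained in \<open>a l\<close>.\<close>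
    have "a l \<le> (q - j) * (?m + ?e)"
      using stair_step(3)[OF \<open>j < q\<close>] A unfolding al by (auto simp: algebra_simps)
    then have "card {t. t < a l \<and> t mod (q - j) = s mod (q - j)} \<le> ?m + ?e"
      by (rule card_mod_class_le)
    moreover have "c l t = c l s \<longleftrightarrow> t mod (q - j) = s mod (q - j)" for t
      using A color_A[of j k] by simp
    ultimately have "card {t. t < a l \<and> c l t = c l s} \<le> ?m + ?e" by simp
    then show ?thesis
      unfolding out_degree_layered[OF assms]
      using prev succ al card_split[of l s] stair_le[of j] stair_step(1)[OF \<open>j < q\<close>] A delta_ge
      by simp
  next
    case (B k j)
    let ?e = "if Suc k = p \<and> Suc j = q then 1 else 0 :: nat"
    let ?m = "Suc (b (Suc j) - b j)"
    have al: "a l = b (Suc j) + ?e" using B size_B by simp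
    have prev: "l \<noteq> 0" "\<delta> - b j \<le> a (l - 1)" using B size_A[of k j] by simp_all
    have succ: "a (Suc l) = 1" using B size_T[of k "Suc j"] by (simp only: Suc_B Suc_leI)
    have "a l \<le> Suc j * (?m + ?e)"
      using stair_step(2)[OF \<open>j < q\<close>] B unfolding al by (auto simp: algebra_simps)
    then have "card {t. t < a l \<and> t mod Suc j = s mod Suc j} \<le> ?m + ?e"
      by (rule card_mod_class_le)
    moreover have "c l t = c l s \<longleftrightarrow> t mod Suc j = s mod Suc j" for t
      using B color_B[of j k] by simp
    ultimately have "card {t. t < a l \<and> c l t = c l s} \<le> ?m + ?e" by simp
    then show ?thesis
      unfolding out_degree_layered[OF assms]
      using prev succ al card_split[of l s] stair_le[of j] stair_step(1)[OF \<open>j < q\<close>] B delta_ge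
      by simp
  qed
qed

lemma min_degree_clump: "min_degree \<G> = \<delta>"
proof -
  \<comment> \<open>The first vertex of the chain attains the bound: it is alone in its layer, has
    nothing below it and sees the \<open>\<delta> - 1\<close> vertices of \<open>A_0\<close> and the
    extra one.\<close>
  have a0: "a 0 = 1" using size_T[of 0 0] p_ge by simp
  have a1: "a (Suc 0) = \<delta>" using size_A[of 0 0] p_ge q_ge delta_ge by simp
  have "out_degree \<G> (prod_encode (0, 0)) = \<delta>"
    using out_degree_layered[of 0 0] a0 a1 by (simp cong: conj_cong)
  moreover have "prod_encode (0, 0) \<in> verts \<G>" using a0 by simp
  ultimately have "\<delta> \<in> out_degree \<G> ` verts \<G>"
    by (intro image_eqI[of _ _ "prod_encode (0, 0)"]) auto
  moreover have "\<delta> \<le> d" if "d \<in> out_degree \<G> ` verts \<G>" for d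
    using that out_degree_ge by (auto simp: layered_verts_eq)
  ultimately show ?thesis
    unfolding min_degree_def by (intro Min_eqI) auto
qed

end

subsection \<open>Comparison of the constants\<close>

text \<open>After cross-multiplication the coefficient of \<open>D\<close> in the numerator
  collapses to 1. The threshold and the limit are both read off from this form.\<close>

lemma diameter_constant_difference:
  fixes R D :: real
  assumes "R \<ge> 2" "D \<ge> 0"
  shows "(6 * R - 5) * D / ((2 * R - 1) * D + 2 * R - 3)
      - 2 * (R - 1) * (3 * R + 2) / (2 * R ^ 2 - 1)
    = (D - 2 * (R - 1) * (3 * R + 2) * (2 * R - 3)) /
      (((2 * R - 1) * D + 2 * R - 3) * (2 * R ^ 2 - 1))"
proof -
  have "0 \<le> (2 * R - 1) * D" using assms by simp
  then have N: "(2 * R - 1) * D + 2 * R - 3 \<noteq> 0" using assms by linarith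
  have "1 \<le> R ^ 2" using assms by simp
  then have K: "2 * R ^ 2 - 1 \<noteq> 0" by linarith
  have "(6 * R - 5) * D * (2 * R ^ 2 - 1) - 2 * (R - 1) * (3 * R + 2) * ((2 * R - 1) * D + 2 * R - 3)
      = D - 2 * (R - 1) * (3 * R + 2) * (2 * R - 3)"
    by (simp add: algebra_simps power2_eq_square)
  then show ?thesis
    by (simp only: diff_frac_eq[OF N K])
qed

lemma threshold_factorization:
  "12 * R ^ 3 - 22 * R ^ 2 - 2 * R + 12 = 2 * (R - 1) * (3 * R + 2) * (2 * R - 3)" for R :: real
  by (simp add: algebra_simps power2_eq_square power3_eq_cube)

lemma diameter_constant_compare:
  fixes R D :: real
  assumes "R \<ge> 2" "D \<ge> 0"
  shows "(6 * R - 5) * D / ((2 * R - 1) * D + 2 * R - 3)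
        > 2 * (R - 1) * (3 * R + 2) / (2 * R ^ 2 - 1)
      \<longleftrightarrow> D > 12 * R ^ 3 - 22 * R ^ 2 - 2 * R + 12"
proof -
  have "0 \<le> (2 * R - 1) * D" using assms by simp
  then have "0 < (2 * R - 1) * D + 2 * R - 3" using assms by linarith
  moreover have "1 \<le> R ^ 2" using assms by simp
  ultimately have "0 < ((2 * R - 1) * D + 2 * R - 3) * (2 * R ^ 2 - 1)" by simp
  then have "0 < (D - 2 * (R - 1) * (3 * R + 2) * (2 * R - 3)) /
        (((2 * R - 1) * D + 2 * R - 3) * (2 * R ^ 2 - 1))
      \<longleftrightarrow> 0 < D - 2 * (R - 1) * (3 * R + 2) * (2 * R - 3)"
    by (metis zero_less_divide_iff less_asym)
  then show ?thesis
    unfolding diameter_constant_difference[OF assms, symmetric] threshold_factorization by linarith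
qed

lemma diameter_constant_limit:
  fixes R :: real
  assumes "R \<ge> 2"
  shows "(\<lambda>\<delta> :: nat. ((6 * R - 5) * real \<delta> / ((2 * R - 1) * real \<delta> + 2 * R - 3)
        - 2 * (R - 1) * (3 * R + 2) / (2 * R ^ 2 - 1))
      - 1 / ((2 * R ^ 2 - 1) * (2 * R - 1))) \<in> o(\<lambda>_. 1)"
proof -
  define T where "T = 2 * (R - 1) * (3 * R + 2) * (2 * R - 3)"
  define K where "K = 2 * R ^ 2 - 1"
  define N where "N \<delta> = (2 * R - 1) * real \<delta> + 2 * R - 3" for \<delta>
  have "1 \<le> R ^ 2" using assms by simp
  then have K: "K \<noteq> 0" by (simp add: K_def)
  have R: "2 * R - 1 \<noteq> 0" using assms by simp
  \<comment> \<open>Subtracting the limit cancels \<open>real \<delta>\<close> from the numerator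
    and leaves a constant over \<open>N \<delta>\<close>.\<close>
  have eq: "((6 * R - 5) * real \<delta> / ((2 * R - 1) * real \<delta> + 2 * R - 3)
        - 2 * (R - 1) * (3 * R + 2) / (2 * R ^ 2 - 1)) - 1 / ((2 * R ^ 2 - 1) * (2 * R - 1))
      = - ((2 * R - 1) * T + 2 * R - 3) / (K * (2 * R - 1)) / N \<delta>" for \<delta>
  proof -
    have "0 \<le> (2 * R - 1) * real \<delta>" using assms by simp
    then have N: "N \<delta> \<noteq> 0" using assms unfolding N_def by linarith
    have "(real \<delta> - T) / (N \<delta> * K) - 1 / (K * (2 * R - 1))
        = ((2 * R - 1) * (real \<delta> - T) - N \<delta>) / (K * (2 * R - 1) * N \<delta>)"
      using N K R by (simp add: field_simps)
    also have "(2 * R - 1) * (real \<delta> - T) - N \<delta> = - ((2 * R - 1) * T + 2 * R - 3)"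
      by (simp add: N_def algebra_simps)
    finally show ?thesis
      using diameter_constant_difference[OF assms, of "real \<delta>"] by (simp add: N_def T_def K_def)
  qed
  have "filterlim N at_top sequentially"
  proof -
    have "filterlim (\<lambda>\<delta>. (2 * R - 3) + (2 * R - 1) * real \<delta>) at_top sequentially"
      using assms
      by (intro filterlim_tendsto_add_at_top[OF tendsto_const]
          filterlim_tendsto_pos_mult_at_top[OF tendsto_const _ filterlim_real_sequentially]) auto
    then show ?thesis by (simp add: N_def[abs_def] algebra_simps)
  qed
  then have "(\<lambda>\<delta>. C / N \<delta>) \<longlonglongrightarrow> 0" for C :: real
    by (intro tendsto_divide_0[OF tendsto_const] filterlim_at_top_imp_at_infinity)
  from this[of "- ((2 * R - 1) * T + 2 * R - 3) / (K * (2 * R - 1))"] show ?thesis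
    by (intro smalloI_tendsto) (simp_all only: eq div_by_1 one_neq_zero not_False_eq_True eventually_True)
qed

section \<open>The family with q = 2r - 2 and its asymptotic diameter\<close>

theorem theorem3p2:
  fixes r :: nat
  assumes "r \<ge> 2"
  shows "(\<exists>G :: nat \<Rightarrow> nat \<Rightarrow> (nat, nat \<times> nat) pre_digraph.
      (\<exists>C :: real. \<forall>\<delta> p. \<delta> \<ge> 2 * r - 2 \<longrightarrow> p \<ge> 1 \<longrightarrow>
          graph (G \<delta> p) \<and>
          Digraph_Component.connected (G \<delta> p) \<and>
          colorable (2 * r - 1) (G \<delta> p) \<and>
          clique_free (2 * r) (G \<delta> p) \<and>
          min_degree (G \<delta> p) = \<delta> \<and>
          card (verts (G \<delta> p)) = p * ((2 * r - 1) * \<delta> + (2 * r - 3)) + 2 \<and>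
          \<bar>graph_diameter (G \<delta> p)
             - ereal ((6 * real r - 5) * real (card (verts (G \<delta> p)))
                 / ((2 * real r - 1) * real \<delta> + 2 * real r - 3))\<bar> \<le> ereal C) \<and>
      (\<forall>\<delta>. \<delta> \<ge> 2 * r - 2 \<and>
           real \<delta> > 12 * real r ^ 3 - 22 * real r ^ 2 - 2 * real r + 12 \<longrightarrow>
           (\<forall>K :: real. \<forall>\<^sub>F p in sequentially.
              graph_diameter (G \<delta> p)
                > ereal (2 * (real r - 1) * (3 * real r + 2) / (2 * real r ^ 2 - 1)
                     * (real (card (verts (G \<delta> p))) / real \<delta>) + K)))) \<and>
    (\<forall>\<delta> :: nat. \<delta> \<ge> 2 * r - 2 \<longrightarrow>
      ((6 * real r - 5) * real \<delta> / ((2 * real r - 1) * real \<delta> + 2 * real r - 3)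
           > 2 * (real r - 1) * (3 * real r + 2) / (2 * real r ^ 2 - 1)
         \<longleftrightarrow> real \<delta> > 12 * real r ^ 3 - 22 * real r ^ 2 - 2 * real r + 12)) \<and>
    12 * real r ^ 3 - 22 * real r ^ 2 - 2 * real r + 12
      = 2 * (real r - 1) * (3 * real r + 2) * (2 * real r - 3) \<and>
    (\<lambda>\<delta> :: nat.
        ((6 * real r - 5) * real \<delta> / ((2 * real r - 1) * real \<delta> + 2 * real r - 3)
           - 2 * (real r - 1) * (3 * real r + 2) / (2 * real r ^ 2 - 1))
        - 1 / ((2 * real r ^ 2 - 1) * (2 * real r - 1))) \<in> o(\<lambda>_. 1)"
proof -
  define q where "q = 2 * r - 2"
  define G where "G \<delta> p = layered_graph (clump_size q \<delta> p) (clump_color q)" for \<delta> p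
  have R: "2 \<le> real r" using assms by simp
  have q: "2 \<le> q" "real q = 2 * real r - 2" "Suc q = 2 * r - 1"
    using assms by (auto simp: q_def of_nat_diff)
  have clump: "clump_layers q \<delta> p" if "\<delta> \<ge> 2 * r - 2" "p \<ge> 1" for \<delta> p
    using that q assms by unfold_locales (auto simp: q_def)
  have card: "card (verts (G \<delta> p)) = p * ((2 * r - 1) * \<delta> + (2 * r - 3)) + 2"
    if "\<delta> \<ge> 2 * r - 2" "p \<ge> 1" for \<delta> p
  proof -
    \<comment> \<open>Writing \<open>r = s + 2\<close> removes the truncated subtractions.\<close>
    obtain s where "r = s + 2" using assms by (metis add.commute le_Suc_ex)
    then have "q * (\<delta> + 1) + \<delta> - 1 = (2 * r - 1) * \<delta> + (2 * r - 3)"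
      by (simp add: q_def algebra_simps)
    then show ?thesis
      using clump_layers.card_verts_clump[OF clump[OF that]] by (simp add: G_def)
  qed
  have diam: "graph_diameter (G \<delta> p) = ereal (real p * (6 * real r - 5) - 1)"
    if "\<delta> \<ge> 2 * r - 2" "p \<ge> 1" for \<delta> p
  proof -
    interpret clump_layers q \<delta> p by (rule clump[OF that])
    have "1 \<le> p * block_length q" using three_layers by linarith
    moreover have "real (block_length q) = 6 * real r - 5"
      using q(2) by (simp add: block_length_def)
    ultimately have "real (p * block_length q - 1) = real p * (6 * real r - 5) - 1"
      by (simp add: of_nat_diff)
    then show ?thesis
      using graph_diameter_layered by (simp add: G_def)
  qed
  have order: "real (card (verts (G \<delta> p))) = real p * ((2 * real r - 1) * real \<delta> + 2 * real r - 3) + 2"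
    if "\<delta> \<ge> 2 * r - 2" "p \<ge> 1" for \<delta> p
    using card[OF that] assms by (simp add: of_nat_diff)
  have N: "1 \<le> (2 * real r - 1) * real \<delta> + 2 * real r - 3" for \<delta>
  proof -
    have "0 \<le> (2 * real r - 1) * real \<delta>" using R by simp
    then show ?thesis using R by linarith
  qed
  have bounded: "\<bar>graph_diameter (G \<delta> p)
             - ereal ((6 * real r - 5) * real (card (verts (G \<delta> p)))
                 / ((2 * real r - 1) * real \<delta> + 2 * real r - 3))\<bar>
      \<le> ereal (1 + 2 * (6 * real r - 5))"
    if "\<delta> \<ge> 2 * r - 2" "p \<ge> 1" for \<delta> p
  proof -
    define n m where "n = (2 * real r - 1) * real \<delta> + 2 * real r - 3" and "m = 6 * real r - 5"
    have n: "1 \<le> n" using N by (simp add: n_def)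
    have m: "0 \<le> m" using R by (simp add: m_def)
    \<comment> \<open>The error is \<open>- 1 - 2 * m / n\<close>; as \<open>1 \<le> n\<close>, it
      is bounded in terms of \<open>r\<close> alone.\<close>
    have "m * (real p * n + 2) / n = real p * m + 2 * m / n"
      using n by (simp add: field_simps)
    moreover have "0 \<le> 2 * m / n" "2 * m / n \<le> 2 * m"
      using n m by (auto simp: divide_le_eq mult_le_cancel_left1)
    ultimately have "\<bar>real p * m - 1 - m * (real p * n + 2) / n\<bar> \<le> 1 + 2 * m"
      by linarith
    then show ?thesis
      unfolding diam[OF that] order[OF that] n_def m_def by simp
  qed
  have exceeds: "\<forall>\<^sub>F p in sequentially. graph_diameter (G \<delta> p)
        > ereal (2 * (real r - 1) * (3 * real r + 2) / (2 * real r ^ 2 - 1)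
             * (real (card (verts (G \<delta> p))) / real \<delta>) + K)"
    if \<delta>: "\<delta> \<ge> 2 * r - 2" "real \<delta> > 12 * real r ^ 3 - 22 * real r ^ 2 - 2 * real r + 12"
    for \<delta> and K :: real
  proof -
    define n m where "n = (2 * real r - 1) * real \<delta> + 2 * real r - 3" and "m = 6 * real r - 5"
    define k where "k = 2 * (real r - 1) * (3 * real r + 2) / (2 * real r ^ 2 - 1)"
    have n: "1 \<le> n" using N by (simp add: n_def)
    have d: "0 < real \<delta>" using \<delta>(1) assms by simp
    have "k < m * real \<delta> / n"
      using diameter_constant_compare[OF R, of "real \<delta>"] \<delta>(2) by (simp add: k_def m_def n_def)
    \<comment> \<open>Each further block adds \<open>m\<close> to the diameter and
      \<open>k * n / real \<delta>\<close> to the term compared with it; the threshold on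
      \<open>\<delta>\<close> makes this gap positive.\<close>
    then have slope: "0 < m - k * n / real \<delta>"
      using n d by (simp add: field_simps)
    \<comment> \<open>For such \<open>p\<close> the accumulated gap outweighs 1 from the diameter,
      \<open>2 * k / real \<delta>\<close> from the two extra vertices, and
      \<open>K\<close>.\<close>
    have "\<forall>\<^sub>F p in sequentially. (1 + K + 2 * k / real \<delta>) / (m - k * n / real \<delta>) < real p"
      using filterlim_real_sequentially by (simp add: filterlim_at_top_dense)
    then show ?thesis
      using eventually_ge_at_top[of 1]
    proof eventually_elim
      case (elim p)
      then have "1 + K + 2 * k / real \<delta> < real p * (m - k * n / real \<delta>)"
        using slope by (simp add: divide_less_eq)
      moreover have "k * ((real p * n + 2) / real \<delta>) = real p * (k * n / real \<delta>) + 2 * k / real \<delta>"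
        by (simp add: add_divide_distrib algebra_simps)
      ultimately have "k * ((real p * n + 2) / real \<delta>) + K < real p * m - 1"
        by (simp add: right_diff_distrib)
      then show ?case
        unfolding diam[OF \<delta>(1) elim(2)] order[OF \<delta>(1) elim(2)] k_def n_def m_def by simp
    qed
  qed
  have "graph (G \<delta> p) \<and> Digraph_Component.connected (G \<delta> p) \<and>
      colorable (2 * r - 1) (G \<delta> p) \<and> clique_free (2 * r) (G \<delta> p) \<and> min_degree (G \<delta> p) = \<delta>"
    if "\<delta> \<ge> 2 * r - 2" "p \<ge> 1" for \<delta> p
  proof -
    interpret clump_layers q \<delta> p by (rule clump[OF that])
    have col: "colorable (2 * r - 1) (G \<delta> p)"
      using colorable_layered[of "Suc q"] color_less q(3) by (simp add: G_def)
    moreover have "clique_free (2 * r) (G \<delta> p)"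
      using assms by (intro colorable_imp_clique_free[OF col]) simp
    ultimately show ?thesis
      using graph_axioms connected_layered min_degree_clump by (simp add: G_def)
  qed
  with card bounded have first: "\<exists>C :: real. \<forall>\<delta> p. \<delta> \<ge> 2 * r - 2 \<longrightarrow> p \<ge> 1 \<longrightarrow>
          graph (G \<delta> p) \<and>
          Digraph_Component.connected (G \<delta> p) \<and>
          colorable (2 * r - 1) (G \<delta> p) \<and>
          clique_free (2 * r) (G \<delta> p) \<and>
          min_degree (G \<delta> p) = \<delta> \<and>
          card (verts (G \<delta> p)) = p * ((2 * r - 1) * \<delta> + (2 * r - 3)) + 2 \<and>
          \<bar>graph_diameter (G \<delta> p)
             - ereal ((6 * real r - 5) * real (card (verts (G \<delta> p)))
                 / ((2 * real r - 1) * real \<delta> + 2 * real r - 3))\<bar> \<le> ereal C"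
    by (intro exI[of _ "1 + 2 * (6 * real r - 5)"] allI impI conjI) simp_all
  show ?thesis
  proof (intro conjI)
    show "\<forall>\<delta> :: nat. \<delta> \<ge> 2 * r - 2 \<longrightarrow>
      ((6 * real r - 5) * real \<delta> / ((2 * real r - 1) * real \<delta> + 2 * real r - 3)
           > 2 * (real r - 1) * (3 * real r + 2) / (2 * real r ^ 2 - 1)
         \<longleftrightarrow> real \<delta> > 12 * real r ^ 3 - 22 * real r ^ 2 - 2 * real r + 12)"
      by (intro allI impI diameter_constant_compare[OF R]) simp
  qed (rule exI[of _ G], intro conjI first allI impI exceeds; (elim conjE; assumption)
      | rule threshold_factorization diameter_constant_limit[OF R])+
qed

end
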